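(* Let $\mathbb{B}_j$ be the open unit ball of a complex Hilbert space $H_j$, $j=1,2$. Let $f:\mathbb{B}_1\to\mathbb{B}_2$ be a pluriharmonic mapping. Assume that $f$ is differentiable at some point $z_0\in\partial\mathbb{B}_1$ and that $f(z_0)=w_0\in\partial\mathbb{B}_2$. Then there exists a constant $\lambda\in\mathbb{R}$ such that $Df(z_0)^*w_0=\lambda z_0$. Moreover, $$\lambda\ \ge\ s^-(b)=\frac{2}{\pi}\cot\Big(\frac{\pi}{4}(1+b)\Big)>0,\qquad\text{where } b=\operatorname{Re}\langle f(0),w_0\rangle .$$ Furthermore, the function $s^-(x)=\frac{2}{\pi}\cot\big(\frac{\pi}{4}(1+x)\big)$ satisfies $s^-(x)\ge\frac{1-x}{2}$ for all $x\in(-1,1)$.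
   Context: A complex Hilbert space $H$ with inner product $\langle\cdot,\cdot\rangle$ is also regarded as a real Hilbert space with inner product $\operatorname{Re}\langle\cdot,\cdot\rangle$; $|\cdot|$ is the norm. A $C^2$-mapping $f:\mathbb{B}_1\to H_2$ is pluriharmonic if for each $w\in H_2$ the restriction of the complex-valued function $z\mapsto\langle f(z),w\rangle$ to every complex line (intersected with $\mathbb{B}_1$) is harmonic. Differentiability at a boundary point $z_0\in\partial\mathbb{B}_1$ means: $f$ extends to $\mathbb{B}_1\cup\{z_0\}$ (the extended value being $f(z_0)$) and there is a bounded real-linear map $Df(z_0):H_1\to H_2$ such that $f(z_0+h)=f(z_0)+Df(z_0)h+o(|h|)$ as $h\to0$ with $z_0+h\in\mathbb{B}_1$. The adjoint $Df(z_0)^*:H_2\to H_1$ is the real adjoint, defined by $\operatorname{Re}\langle Df(z_0)^*w,z\rangle_{H_1}=\operatorname{Re}\langle w,Df(z_0)z\rangle_{H_2}$ for all $z\in H_1$, $w\in H_2$. *)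

theory Defs
  imports "HOL-Analysis.Analysis"
begin

(* A complex inner product space is a real inner product space whose real structure is the one
   underlying the complex structure: the class operation inner is Re (cinner _ _), and hence norm,
   the topology and real adjoints are those of the space regarded as a real inner product space.
   cinner is complex linear in its first argument. *)
class complex_inner = real_inner +
  fixes scaleC :: "complex \<Rightarrow> 'a \<Rightarrow> 'a" (infixr "*\<^sub>C" 75)
    and cinner :: "'a \<Rightarrow> 'a \<Rightarrow> complex"
  assumes scaleC_add_right: "c *\<^sub>C (x + y) = c *\<^sub>C x + c *\<^sub>C y"
    and scaleC_add_left: "(c + d) *\<^sub>C x = c *\<^sub>C x + d *\<^sub>C x"
    and scaleC_scaleC: "c *\<^sub>C d *\<^sub>C x = (c * d) *\<^sub>C x"
    and scaleC_of_real: "complex_of_real r *\<^sub>C x = r *\<^sub>R x"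
    and cinner_add_left: "cinner (x + y) z = cinner x z + cinner y z"
    and cinner_scaleC_left: "cinner (c *\<^sub>C x) y = c * cinner x y"
    and cinner_commute: "cinner x y = cnj (cinner y x)"
    and Re_cinner: "Re (cinner x y) = inner x y"

class complex_hilbert = complex_inner + complete_space

instantiation complex :: complex_hilbert
begin

definition scaleC_complex :: "complex \<Rightarrow> complex \<Rightarrow> complex" where
  "scaleC_complex c x = c * x"

definition cinner_complex :: "complex \<Rightarrow> complex \<Rightarrow> complex" where
  "cinner_complex x y = x * cnj y"

instance
  by standard
    (auto simp: scaleC_complex_def cinner_complex_def algebra_simps scaleR_conv_of_real
      inner_complex_def)

end

(* f' and f'' are the first and second Frechet derivatives over the reals, and f'' is continuous
   in operator norm. Derivatives are taken in the full space, so S is meant to be open;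
   f' and f'' are then uniquely determined on S. *)
definition has_C2_derivatives_on ::
  "('a::real_normed_vector \<Rightarrow> 'b::real_normed_vector) \<Rightarrow>
   ('a \<Rightarrow> 'a \<Rightarrow>\<^sub>L 'b) \<Rightarrow> ('a \<Rightarrow> 'a \<Rightarrow>\<^sub>L 'a \<Rightarrow>\<^sub>L 'b) \<Rightarrow> 'a set \<Rightarrow> bool" where
  "has_C2_derivatives_on f f' f'' S \<longleftrightarrow>
     (\<forall>x\<in>S. (f has_derivative blinfun_apply (f' x)) (at x)) \<and>
     (\<forall>x\<in>S. (f' has_derivative blinfun_apply (f'' x)) (at x)) \<and>
     continuous_on S f''"

definition C2_on :: "('a::real_normed_vector \<Rightarrow> 'b::real_normed_vector) \<Rightarrow> 'a set \<Rightarrow> bool" where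
  "C2_on f S \<longleftrightarrow> (\<exists>f' f''. has_C2_derivatives_on f f' f'' S)"

(* With \<zeta> = x + i y, the values f'' \<zeta> 1 1 and f'' \<zeta> \<i> \<i> are the second partial
   derivatives in x and in y, so the last conjunct is Laplace's equation. *)
definition harmonic_on :: "(complex \<Rightarrow> complex) \<Rightarrow> complex set \<Rightarrow> bool" where
  "harmonic_on g S \<longleftrightarrow>
     (\<exists>g' g''. has_C2_derivatives_on g g' g'' S \<and>
       (\<forall>\<zeta>\<in>S. blinfun_apply (blinfun_apply (g'' \<zeta>) 1) 1
              + blinfun_apply (blinfun_apply (g'' \<zeta>) \<i>) \<i> = 0))"

(* The complex lines are parametrized as \<zeta> \<mapsto> a + \<zeta> v with v nonzero. *)
definition pluriharmonic_on ::
  "('a::complex_hilbert \<Rightarrow> 'b::complex_hilbert) \<Rightarrow> 'a set \<Rightarrow> bool" where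
  "pluriharmonic_on f S \<longleftrightarrow> C2_on f S \<and>
     (\<forall>w a v. v \<noteq> 0 \<longrightarrow>
        harmonic_on (\<lambda>\<zeta>. cinner (f (a + \<zeta> *\<^sub>C v)) w) {\<zeta>. a + \<zeta> *\<^sub>C v \<in> S})"

definition s_minus :: "real \<Rightarrow> real" where
  "s_minus x = 2 / pi * cot (pi / 4 * (1 + x))"

end

theory Submission
  imports Defs "HOL-Complex_Analysis.Conformal_Mappings"
begin

text \<open>
  Put $u(z) = \mathrm{Re} \langle f(z), w_0\rangle$, so that $|u| < 1$ in the ball and $u(z_0) = 1$.
  Since $u$ cannot increase from $z_0$ into the ball, the functional
  $v \mapsto \mathrm{Re} \langle Df(z_0) v, w_0\rangle$ is nonpositive on the half-space
  $\mathrm{Re} \langle v, z_0\rangle < 0$, hence it is represented by a multiple $\lambda z_0$.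
  On the disc $\zeta \mapsto \zeta z_0$ the harmonic function $u$ is the real part of a holomorphic $F$,
  and $Q = \exp(i \pi F / 2)$ maps the disc to the right half-plane. The Schwarz-Pick inequality for $Q$,
  written in terms of the arguments of $Q(\zeta)$ and $Q(0)$ only, yields the bound on $\lambda$
  on dividing by $1 - |\zeta|$ and letting $\zeta \to 1$.
\<close>

section \<open>Riesz representation and the real adjoint\<close>

lemma riesz_representation:
  fixes \<phi> :: "'a::{real_inner,complete_space} \<Rightarrow> real"
  assumes "bounded_linear \<phi>"
  obtains g where "\<And>v. \<phi> v = inner v g"
proof -
  interpret bounded_linear \<phi> by fact
  \<comment> \<open>The representing vector is the minimiser of the quadratic functional J; minimising
    sequences are Cauchy by the parallelogram identity.\<close>
  define J where "J x = (norm x)\<^sup>2 - 2 * \<phi> x" for x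
  define m where "m = (INF x. J x)"
  obtain K where K: "\<And>x. norm (\<phi> x) \<le> norm x * K"
    using bounded by blast
  have "- (K\<^sup>2) \<le> J x" for x
  proof -
    have "0 \<le> (norm x - K)\<^sup>2" by simp
    moreover have "\<phi> x \<le> norm x * K" using K[of x] by simp
    ultimately show ?thesis by (simp add: J_def power2_diff)
  qed
  then have bdd: "bdd_below (range J)" by (meson bdd_belowI2)
  then have mle: "m \<le> J x" for x unfolding m_def by (simp add: cINF_lower)
  have "\<exists>x. J x < m + inverse (real (Suc n))" for n
    using cINF_less_iff[OF _ bdd, of "m + inverse (real (Suc n))"] unfolding m_def by auto
  then obtain X where X: "\<And>n. J (X n) < m + inverse (real (Suc n))" by metis
  have par: "(norm (x - y))\<^sup>2 \<le> 2 * (J x + J y - 2 * m)" for x y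
  proof -
    \<comment> \<open>The terms in \<open>\<phi>\<close> cancel, because \<open>\<phi>\<close> at
      the midpoint is the mean of its two values; what remains is the parallelogram
      identity.\<close>
    have "(norm (x - y))\<^sup>2 = 2 * (J x + J y - 2 * J ((1/2) *\<^sub>R (x + y)))"
      unfolding J_def power2_norm_eq_inner
      by (simp add: add scaleR inner_simps inner_commute algebra_simps)
    also have "\<dots> \<le> 2 * (J x + J y - 2 * m)"
      by (intro mult_left_mono diff_left_mono mle) auto
    finally show ?thesis .
  qed
  have "Cauchy X"
  proof (rule metric_CauchyI)
    fix e :: real assume "e > 0"
    \<comment> \<open>Each of the two values of \<open>J\<close> exceeds \<open>m\<close> by less
      than a quarter of the squared tolerance, and \<open>par\<close> doubles their sum.\<close>
    then obtain N where N: "inverse (real (Suc N)) < e\<^sup>2 / 4"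
      using reals_Archimedean[of "e\<^sup>2 / 4"] by auto
    show "\<exists>M. \<forall>m\<ge>M. \<forall>n\<ge>M. dist (X m) (X n) < e"
    proof (intro exI allI impI)
      fix i j assume "N \<le> i" "N \<le> j"
      then have "inverse (real (Suc i)) \<le> inverse (real (Suc N))"
        "inverse (real (Suc j)) \<le> inverse (real (Suc N))"
        by (simp_all add: le_imp_inverse_le)
      with X[of i] X[of j] N have "J (X i) < m + e\<^sup>2 / 4" "J (X j) < m + e\<^sup>2 / 4"
        by (meson add_strict_left_mono le_less_trans less_trans)+
      then have "2 * (J (X i) + J (X j) - 2 * m) < e\<^sup>2" by argo
      with par[of "X i" "X j"] have "(norm (X i - X j))\<^sup>2 < e\<^sup>2" by (rule le_less_trans)
      then show "dist (X i) (X j) < e"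
        using \<open>e > 0\<close> by (simp add: dist_norm power2_less_imp_less)
    qed
  qed
  then obtain x where x: "X \<longlonglongrightarrow> x"
    using Cauchy_convergent convergent_def by blast
  have "(\<lambda>n. J (X n)) \<longlonglongrightarrow> J x"
    unfolding J_def by (intro tendsto_intros x tendsto)
  moreover have "(\<lambda>n. m + inverse (real (Suc n))) \<longlonglongrightarrow> m + 0"
    by (intro tendsto_intros LIMSEQ_inverse_real_of_nat)
  ultimately have "J x \<le> m + 0"
    by (rule LIMSEQ_le) (use X less_imp_le in blast)
  then have min: "J x \<le> J y" for y using mle[of y] by simp
  have "\<phi> v = inner v x" for v
  proof (rule ccontr)
    assume ne: "\<phi> v \<noteq> inner v x"
    then have v: "v \<noteq> 0" using zero by auto
    define d where "d = \<phi> v - inner v x"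
    \<comment> \<open>This is the minimiser of the quadratic polynomial
      \<open>t \<mapsto> J (x + t *\<^sub>R v)\<close>.\<close>
    define t where "t = d / (norm v)\<^sup>2"
    have "J (x + t *\<^sub>R v) = J x - 2 * t * d + t\<^sup>2 * (norm v)\<^sup>2"
      unfolding J_def d_def power2_norm_eq_inner
      by (simp add: add scaleR inner_simps inner_commute algebra_simps power2_eq_square)
    also have "\<dots> = J x - d\<^sup>2 / (norm v)\<^sup>2"
      using v by (simp add: t_def field_simps power2_eq_square)
    finally have "d\<^sup>2 / (norm v)\<^sup>2 \<le> 0" using min[of "x + t *\<^sub>R v"] by simp
    moreover have "d\<^sup>2 / (norm v)\<^sup>2 > 0" using v ne by (simp add: d_def)
    ultimately show False by simp
  qed
  then show thesis using that by blast
qed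

text \<open>\<open>adjoint\<close> is defined by choice, so its defining identity needs an existence
  proof: Riesz representation of \<open>v \<mapsto> inner (D v) w\<close> provides a candidate, and
  uniqueness identifies it with \<open>adjoint D\<close>.\<close>

lemma inner_adjoint:
  fixes D :: "'a::{real_inner,complete_space} \<Rightarrow> 'b::real_inner"
  assumes "bounded_linear D"
  shows "inner v (adjoint D w) = inner (D v) w"
proof -
  have "\<exists>g. \<forall>v. inner (D v) w = inner v g" for w
  proof -
    have "bounded_linear (\<lambda>v. inner (D v) w)"
      by (rule bounded_linear_compose[OF bounded_linear_inner_left assms])
    then show ?thesis by (metis riesz_representation)
  qed
  then obtain E where E: "\<And>v w. inner (D v) w = inner v (E w)" by metis
  then have "adjoint D = E" by (simp add: adjoint_unique)
  with E show ?thesis by simp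
qed

section \<open>Complex multiples, and harmonic functions as real parts of holomorphic ones\<close>

lemma norm_scaleC: "norm (c *\<^sub>C x) = cmod c * norm (x::'a::complex_inner)"
proof -
  have "cinner (c *\<^sub>C x) (c *\<^sub>C x) = c * cnj (c * cinner x x)"
    by (metis cinner_scaleC_left cinner_commute)
  also have "\<dots> = of_real ((cmod c)\<^sup>2) * cnj (cinner x x)"
    by (simp add: complex_norm_square mult.assoc del: of_real_power)
  finally have "inner (c *\<^sub>C x) (c *\<^sub>C x) = (cmod c)\<^sup>2 * inner x x"
    by (simp only: flip: Re_cinner) simp
  then show ?thesis
    by (metis norm_eq_sqrt_inner norm_ge_zero power2_norm_eq_inner power_mult_distrib real_sqrt_abs abs_of_nonneg mult_nonneg_nonneg)
qed

text \<open>The second difference is symmetric in h and k, which gives the symmetry of the second derivative.\<close>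

lemma second_difference:
  fixes \<phi> :: "'a::real_normed_vector \<Rightarrow> real"
  assumes d1: "\<And>x. x \<in> S \<Longrightarrow> (\<phi> has_derivative \<phi>' x) (at x)"
    and d2: "\<And>x. x \<in> S \<Longrightarrow> ((\<lambda>x. \<phi>' x h) has_derivative B x) (at x)"
    and S: "\<And>a b. a \<in> {0..s} \<Longrightarrow> b \<in> {0..s} \<Longrightarrow> z + a *\<^sub>R h + b *\<^sub>R k \<in> S"
    and "0 < s"
  obtains a b where "a \<in> {0..s}" "b \<in> {0..s}"
    "\<phi> (z + s *\<^sub>R h + s *\<^sub>R k) - \<phi> (z + s *\<^sub>R h) - \<phi> (z + s *\<^sub>R k) + \<phi> z
      = s * s * B (z + a *\<^sub>R h + b *\<^sub>R k) k"
proof -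
  have S0: "z + a *\<^sub>R h \<in> S" if "a \<in> {0..s}" for a
    using S[OF that, of 0] \<open>0 < s\<close> by simp
  \<comment> \<open>The second difference is the increment of \<open>g\<close> over
    \<open>[0, s]\<close>. The mean value theorem along \<open>h\<close> turns it into a difference
    of first derivatives, and a second application along \<open>k\<close> produces
    \<open>B\<close>.\<close>
  define g where "g a = \<phi> (z + a *\<^sub>R h + s *\<^sub>R k) - \<phi> (z + a *\<^sub>R h)" for a
  have "\<exists>a\<in>{0<..<s}. g s - g 0
      = (\<lambda>r. \<phi>' (z + a *\<^sub>R h + s *\<^sub>R k) (r *\<^sub>R h) - \<phi>' (z + a *\<^sub>R h) (r *\<^sub>R h)) (s - 0)"
  proof (rule mvt_simple[OF \<open>0 < s\<close>])
    fix a assume a: "0 \<le> a" "a \<le> s"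
    have 1: "((\<lambda>a. \<phi> (z + a *\<^sub>R h + s *\<^sub>R k)) has_derivative
        (\<lambda>r. \<phi>' (z + a *\<^sub>R h + s *\<^sub>R k) (r *\<^sub>R h))) (at a within {0..s})"
      by (rule has_derivative_compose[OF _ d1]) (use a S \<open>0 < s\<close> in \<open>auto intro!: derivative_eq_intros\<close>)
    have 2: "((\<lambda>a. \<phi> (z + a *\<^sub>R h)) has_derivative
        (\<lambda>r. \<phi>' (z + a *\<^sub>R h) (r *\<^sub>R h))) (at a within {0..s})"
      by (rule has_derivative_compose[OF _ d1]) (use a S0 in \<open>auto intro!: derivative_eq_intros\<close>)
    show "(g has_derivative (\<lambda>r. \<phi>' (z + a *\<^sub>R h + s *\<^sub>R k) (r *\<^sub>R h) - \<phi>' (z + a *\<^sub>R h) (r *\<^sub>R h)))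
        (at a within {0..s})"
      unfolding g_def by (rule has_derivative_diff[OF 1 2])
  qed
  then obtain a where a: "a \<in> {0<..<s}" and
    ga: "g s - g 0 = \<phi>' (z + a *\<^sub>R h + s *\<^sub>R k) (s *\<^sub>R h) - \<phi>' (z + a *\<^sub>R h) (s *\<^sub>R h)" by auto
  have lin: "\<phi>' x (s *\<^sub>R h) = s * \<phi>' x h" if "x \<in> S" for x
    using linear_scale[OF has_derivative_linear[OF d1[OF that]]] by simp
  have "\<exists>b\<in>{0<..<s}. \<phi>' (z + a *\<^sub>R h + s *\<^sub>R k) h - \<phi>' (z + a *\<^sub>R h + 0 *\<^sub>R k) h
      = (\<lambda>r. B (z + a *\<^sub>R h + b *\<^sub>R k) (r *\<^sub>R k)) (s - 0)"
  proof (rule mvt_simple[OF \<open>0 < s\<close>])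
    fix b assume b: "0 \<le> b" "b \<le> s"
    show "((\<lambda>b. \<phi>' (z + a *\<^sub>R h + b *\<^sub>R k) h) has_derivative
        (\<lambda>r. B (z + a *\<^sub>R h + b *\<^sub>R k) (r *\<^sub>R k))) (at b within {0..s})"
      by (rule has_derivative_compose[OF _ d2]) (use a b S in \<open>auto intro!: derivative_eq_intros\<close>)
  qed
  then obtain b where b: "b \<in> {0<..<s}" and
    gb: "\<phi>' (z + a *\<^sub>R h + s *\<^sub>R k) h - \<phi>' (z + a *\<^sub>R h) h = B (z + a *\<^sub>R h + b *\<^sub>R k) (s *\<^sub>R k)" by auto
  have "z + a *\<^sub>R h + b *\<^sub>R k \<in> S" using S a b by auto
  then have "B (z + a *\<^sub>R h + b *\<^sub>R k) (s *\<^sub>R k) = s * B (z + a *\<^sub>R h + b *\<^sub>R k) k"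
    using linear_scale[OF has_derivative_linear[OF d2]] by simp
  moreover have "z + a *\<^sub>R h + s *\<^sub>R k \<in> S" "z + a *\<^sub>R h \<in> S" using S S0 a \<open>0 < s\<close> by auto
  ultimately have "g s - g 0 = s * s * B (z + a *\<^sub>R h + b *\<^sub>R k) k"
    using ga gb lin by (metis mult.assoc right_diff_distrib)
  then show thesis using that[of a b] a b by (simp add: g_def)
qed

text \<open>One and the same second difference equals \<open>s * s\<close> times a value of
  \<open>B\<close> near \<open>z\<close> in either order of the arguments. By continuity at
  \<open>z\<close>, distinct limits would keep these values apart on a small parallelogram.\<close>

lemma symmetric_second_derivative:
  fixes \<phi> :: "'a::real_normed_vector \<Rightarrow> real"
  assumes "open S" "z \<in> S"
    and d1: "\<And>x. x \<in> S \<Longrightarrow> (\<phi> has_derivative \<phi>' x) (at x)"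
    and d2: "\<And>x v. x \<in> S \<Longrightarrow> ((\<lambda>x. \<phi>' x v) has_derivative B x v) (at x)"
    and cont: "\<And>v w. continuous (at z) (\<lambda>x. B x v w)"
  shows "B z h k = B z k h"
proof (rule ccontr)
  assume ne: "B z h k \<noteq> B z k h"
  \<comment> \<open>Half the gap, so that the open intervals of radius \<open>e\<close> around the
    two values are disjoint.\<close>
  define e where "e = \<bar>B z h k - B z k h\<bar> / 2"
  have "e > 0" using ne by (simp add: e_def)
  obtain d1 where d1': "d1 > 0" "\<And>x. dist x z < d1 \<Longrightarrow> dist (B x h k) (B z h k) < e"
    using cont[of h k] \<open>e > 0\<close> unfolding continuous_at_eps_delta by blast
  obtain d2 where d2': "d2 > 0" "\<And>x. dist x z < d2 \<Longrightarrow> dist (B x k h) (B z k h) < e"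
    using cont[of k h] \<open>e > 0\<close> unfolding continuous_at_eps_delta by blast
  obtain d3 where d3: "d3 > 0" "\<And>x. dist x z < d3 \<Longrightarrow> x \<in> S"
    using \<open>open S\<close> \<open>z \<in> S\<close> unfolding open_dist by blast
  define d where "d = min d1 (min d2 d3)"
  have "d > 0" using d1' d2' d3 by (simp add: d_def)
  \<comment> \<open>The parallelogram spanned by \<open>s *\<^sub>R h\<close> and
    \<open>s *\<^sub>R k\<close> then stays within distance \<open>d\<close> of \<open>z\<close>.
    The summand 1 keeps the denominator positive and the bound strict.\<close>
  define s where "s = d / (norm h + norm k + 1)"
  have den: "norm h + norm k + 1 > 0" by (smt (verit) norm_ge_zero)
  have "s > 0" using \<open>d > 0\<close> den by (simp add: s_def)
  have near: "dist (z + a *\<^sub>R h + b *\<^sub>R k) z < d" if "a \<in> {0..s}" "b \<in> {0..s}" for a b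
  proof -
    have "dist (z + a *\<^sub>R h + b *\<^sub>R k) z \<le> norm (a *\<^sub>R h) + norm (b *\<^sub>R k)"
      unfolding dist_norm by (metis add_diff_cancel_left' add.assoc norm_triangle_ineq)
    also have "\<dots> \<le> s * norm h + s * norm k"
      using that by (intro add_mono) (auto intro: mult_right_mono)
    also have "\<dots> < s * (norm h + norm k + 1)" using \<open>s > 0\<close> by (simp add: algebra_simps)
    also have "\<dots> = d" using den by (simp add: s_def)
    finally show ?thesis .
  qed
  have near': "dist (z + a *\<^sub>R k + b *\<^sub>R h) z < d" if "a \<in> {0..s}" "b \<in> {0..s}" for a b
    using near[OF that(2,1)] by (simp add: add.commute add.left_commute)
  obtain a b where ab: "a \<in> {0..s}" "b \<in> {0..s}"
    "\<phi> (z + s *\<^sub>R h + s *\<^sub>R k) - \<phi> (z + s *\<^sub>R h) - \<phi> (z + s *\<^sub>R k) + \<phi> z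
      = s * s * B (z + a *\<^sub>R h + b *\<^sub>R k) h k"
    by (rule second_difference[OF d1 d2, of S s z h k])
      (use near d3 \<open>s > 0\<close> in \<open>auto simp: d_def\<close>)
  obtain a' b' where ab': "a' \<in> {0..s}" "b' \<in> {0..s}"
    "\<phi> (z + s *\<^sub>R k + s *\<^sub>R h) - \<phi> (z + s *\<^sub>R k) - \<phi> (z + s *\<^sub>R h) + \<phi> z
      = s * s * B (z + a' *\<^sub>R k + b' *\<^sub>R h) k h"
    by (rule second_difference[OF d1 d2, of S s z k h])
      (use near' d3 \<open>s > 0\<close> in \<open>auto simp: d_def\<close>)
  have "z + s *\<^sub>R k + s *\<^sub>R h = z + s *\<^sub>R h + s *\<^sub>R k" by simp
  then have "s * s * B (z + a *\<^sub>R h + b *\<^sub>R k) h k = s * s * B (z + a' *\<^sub>R k + b' *\<^sub>R h) k h"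
    using ab(3) ab'(3) by (simp only:)
  then have "B (z + a *\<^sub>R h + b *\<^sub>R k) h k = B (z + a' *\<^sub>R k + b' *\<^sub>R h) k h"
    using \<open>s > 0\<close> by simp
  moreover have "dist (B (z + a *\<^sub>R h + b *\<^sub>R k) h k) (B z h k) < e"
    using d1'(2) near[OF ab(1,2)] by (simp add: d_def)
  moreover have "dist (B (z + a' *\<^sub>R k + b' *\<^sub>R h) k h) (B z k h) < e"
    using d2'(2) near'[OF ab'(1,2)] by (simp add: d_def)
  ultimately show False unfolding e_def dist_real_def by (smt (verit) field_sum_of_halves)
qed

text \<open>A holomorphic function with real part u = Re g must have derivative u_x - i u_y, which
  is \<open>\<Phi>\<close>. Laplace's equation and the symmetry of second derivatives are the
  Cauchy-Riemann equations for \<open>\<Phi>\<close>; convexity then gives a primitive, whose real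
  part differs from u by a constant.\<close>

lemma harmonic_on_imp_Re_holomorphic:
  assumes "harmonic_on g S" "open S" "convex S" "z0 \<in> S"
  obtains F where "F holomorphic_on S" "\<And>z. z \<in> S \<Longrightarrow> Re (F z) = Re (g z)" "Im (F z0) = 0"
proof -
  obtain g' g'' where g': "\<And>x. x \<in> S \<Longrightarrow> (g has_derivative blinfun_apply (g' x)) (at x)"
    and g'': "\<And>x. x \<in> S \<Longrightarrow> (g' has_derivative blinfun_apply (g'' x)) (at x)"
    and cont: "continuous_on S g''"
    and lap: "\<And>x. x \<in> S \<Longrightarrow> g'' x 1 1 + g'' x \<i> \<i> = 0"
    using assms(1) unfolding harmonic_on_def has_C2_derivatives_on_def by blast
  have d1: "((\<lambda>x. Re (g x)) has_derivative (\<lambda>h. Re (g' x h))) (at x)" if "x \<in> S" for x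
    by (rule has_derivative_Re[OF g'[OF that]])
  have d2: "((\<lambda>x. Re (g' x v)) has_derivative (\<lambda>h. Re (g'' x h v))) (at x)" if "x \<in> S" for x v
    using g''[OF that] by (auto intro!: derivative_eq_intros)
  have sym: "Re (g'' x k h) = Re (g'' x h k)" if "x \<in> S" for x h k
  proof (rule symmetric_second_derivative[OF \<open>open S\<close> that d1 d2])
    have "continuous (at x) g''" using cont that \<open>open S\<close> by (simp add: continuous_on_eq_continuous_at)
    then have "((\<lambda>y. Re (g'' y w v)) \<longlongrightarrow> Re (g'' x w v)) (at x)" for v w
      unfolding continuous_at by (intro tendsto_intros)
    then show "continuous (at x) (\<lambda>y. Re (g'' y w v))" for v w
      by (simp add: continuous_at)
  qed
  define \<Phi> where "\<Phi> x = complex_of_real (Re (g' x 1)) - \<i> * complex_of_real (Re (g' x \<i>))" for x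
  have blin: "blinfun_apply L h = Re h *\<^sub>R L 1 + Im h *\<^sub>R L \<i>" for L :: "complex \<Rightarrow>\<^sub>L 'z::real_normed_vector" and h
  proof -
    have "h = Re h *\<^sub>R 1 + Im h *\<^sub>R \<i>" by (simp add: complex_eq_iff)
    then show ?thesis by (metis blinfun.add_right blinfun.scaleR_right)
  qed
  have "\<Phi> field_differentiable at x" if "x \<in> S" for x
  proof -
    \<comment> \<open>These are u_xx and u_xy; they determine all second partials at
      \<open>x\<close>, and \<open>\<Phi>\<close> has complex derivative A - iB.\<close>
    define A B where "A = Re (g'' x 1 1)" and "B = Re (g'' x \<i> 1)"
    have ii: "Re (g'' x \<i> \<i>) = - A" using arg_cong[OF lap[OF that], of Re] by (simp add: A_def)
    have i1: "Re (g'' x 1 \<i>) = B" using sym[OF that] by (simp add: B_def)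
    have "(\<Phi> has_derivative (\<lambda>h. complex_of_real (Re (g'' x h 1)) - \<i> * complex_of_real (Re (g'' x h \<i>)))) (at x)"
      unfolding \<Phi>_def
      by (rule has_derivative_diff[OF has_derivative_of_real[OF d2[OF that]]
            has_derivative_mult_right[OF has_derivative_of_real[OF d2[OF that]]]])
    moreover have "complex_of_real (Re (g'' x h 1)) - \<i> * complex_of_real (Re (g'' x h \<i>)) = Complex A (- B) * h" for h
      unfolding blin[of "g'' x" h]
      by (simp add: complex_eq_iff blinfun.add_left blinfun.scaleR_left ii i1 flip: A_def B_def)
    ultimately have "(\<Phi> has_field_derivative Complex A (- B)) (at x)"
      unfolding has_field_derivative_def by simp
    then show ?thesis by (auto simp: field_differentiable_def)
  qed
  then have "\<Phi> holomorphic_on S"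
    by (simp add: holomorphic_on_def field_differentiable_at_within)
  then obtain G where G: "\<And>x. x \<in> S \<Longrightarrow> (G has_field_derivative \<Phi> x) (at x within S)"
    using holomorphic_convex_primitive' assms(2,3) by blast
  have "((\<lambda>x. Re (G x) - Re (g x)) has_derivative (\<lambda>h. 0)) (at x within S)" if "x \<in> S" for x
  proof -
    have "((\<lambda>x. Re (G x) - Re (g x)) has_derivative (\<lambda>h. Re (\<Phi> x * h) - Re (g' x h))) (at x within S)"
      by (intro has_derivative_diff has_derivative_Re has_derivative_at_withinI[OF g'] that
          G[unfolded has_field_derivative_def])
    moreover have "Re (\<Phi> x * h) - Re (g' x h) = 0" for h
      unfolding blin[of "g' x" h] by (simp add: \<Phi>_def)
    ultimately show ?thesis by simp
  qed
  from has_derivative_zero_constant[OF \<open>convex S\<close> this]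
  obtain c where c: "\<And>x. x \<in> S \<Longrightarrow> Re (G x) - Re (g x) = c"
    by blast
  show thesis
  proof
    show "(\<lambda>z. G z - (c + \<i> * Im (G z0))) holomorphic_on S"
      using G by (intro holomorphic_intros) (auto simp: holomorphic_on_def field_differentiable_def)
    show "Re (G z - (c + \<i> * Im (G z0))) = Re (g z)" if "z \<in> S" for z
      using c[OF that] by simp
  qed simp
qed

section \<open>A Schwarz-Pick inequality for maps into the strip\<close>

lemma cos_half_pi_pos:
  assumes "\<bar>x\<bar> < 1"
  shows "cos (pi / 2 * x) > 0"
proof -
  have "pi / 2 * x < pi / 2 * 1" "pi / 2 * (- 1) < pi / 2 * x"
    using assms by (intro mult_strict_left_mono; simp add: abs_less_iff)+
  then show ?thesis by (intro cos_gt_zero_pi) auto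
qed

text \<open>The full Schwarz-Pick inequality for \<open>Q\<close> also involves the modulus of
  \<open>Q z\<close>. It is eliminated by the arithmetic-geometric mean inequality, leaving a bound
  in the real parts of \<open>F\<close> alone; the normalisation of \<open>F\<close> at 0 makes
  \<open>Q 0\<close> unimodular.\<close>

lemma strip_schwarz_pick:
  assumes holF: "F holomorphic_on ball 0 1" and Re1: "\<And>z. norm z < 1 \<Longrightarrow> \<bar>Re (F z)\<bar> < 1"
    and F0: "Im (F 0) = 0" and z: "norm z < 1"
  shows "(1 - (norm z)\<^sup>2) * (1 - sin (pi / 2 * Re (F z)) * sin (pi / 2 * Re (F 0)))
    \<le> (1 + (norm z)\<^sup>2) * (cos (pi / 2 * Re (F z)) * cos (pi / 2 * Re (F 0)))"
proof -
  define Q where "Q \<zeta> = exp (\<i> * of_real (pi / 2) * F \<zeta>)" for \<zeta>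
  have ReQ: "Re (Q \<zeta>) > 0" if "norm \<zeta> < 1" for \<zeta>
    using cos_half_pi_pos[OF Re1[OF that]] by (simp add: Q_def Re_exp)
  define q where "q = Q 0"
  \<comment> \<open>Composition with the Moebius map that sends the right half-plane to the unit
    disc and \<open>q\<close> to 0, so that the Schwarz lemma applies.\<close>
  define h where "h \<zeta> = (Q \<zeta> - q) / (Q \<zeta> + cnj q)" for \<zeta>
  have Req: "Re q > 0" using ReQ[of 0] by (simp add: q_def)
  have den: "Q \<zeta> + cnj q \<noteq> 0" if "norm \<zeta> < 1" for \<zeta>
    using ReQ[OF that] Req by (auto simp: complex_eq_iff)
  have holh: "h holomorphic_on ball 0 1"
    unfolding h_def Q_def by (intro holomorphic_intros holF) (use den in \<open>auto simp: Q_def\<close>)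
  have h0: "h 0 = 0" by (simp add: h_def q_def)
  have diff: "(cmod (w + cnj q))\<^sup>2 = (cmod (w - q))\<^sup>2 + 4 * (Re w * Re q)" for w
    unfolding cmod_power2 by (simp add: power2_eq_square algebra_simps)
  have h1: "norm (h \<zeta>) < 1" if "norm \<zeta> < 1" for \<zeta>
  proof -
    have "(cmod (Q \<zeta> - q))\<^sup>2 < (cmod (Q \<zeta> + cnj q))\<^sup>2"
      using diff[of "Q \<zeta>"] ReQ[OF that] Req by simp
    then have "cmod (Q \<zeta> - q) < cmod (Q \<zeta> + cnj q)" by (simp add: power2_less_imp_less)
    then show ?thesis using den[OF that] by (simp add: h_def norm_divide)
  qed
  have "norm (h z) \<le> norm z" by (rule Schwarz_Lemma(1)[OF holh h0 h1 z])
  then have "cmod (Q z - q) \<le> norm z * cmod (Q z + cnj q)"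
    using den[OF z] by (simp add: h_def norm_divide field_simps)
  then have "(cmod (Q z - q))\<^sup>2 \<le> (norm z * cmod (Q z + cnj q))\<^sup>2"
    by (intro power_mono) auto
  then have le: "(cmod (Q z - q))\<^sup>2 \<le> (norm z)\<^sup>2 * (cmod (Q z + cnj q))\<^sup>2"
    by (simp add: power_mult_distrib)
  \<comment> \<open>\<open>R\<close> is the modulus of \<open>Q z\<close>; \<open>\<alpha>\<close>
    and \<open>\<beta>\<close> are the arguments of \<open>Q z\<close> and
    \<open>Q 0\<close>.\<close>
  define R \<alpha> \<beta> where "R = exp (- (pi / 2 * Im (F z)))" and "\<alpha> = pi / 2 * Re (F z)"
    and "\<beta> = pi / 2 * Re (F 0)"
  have Qz: "Re (Q z) = R * cos \<alpha>" "Im (Q z) = R * sin \<alpha>"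
    by (simp_all add: Q_def R_def \<alpha>_def Re_exp Im_exp)
  have qq: "Re q = cos \<beta>" "Im q = sin \<beta>"
    using F0 by (simp_all add: Q_def q_def \<beta>_def Re_exp Im_exp)
  have "R > 0" by (simp add: R_def)
  have minus: "(cmod (Q z - q))\<^sup>2 = R\<^sup>2 + 1 - 2 * R * (cos \<alpha> * cos \<beta> + sin \<alpha> * sin \<beta>)"
    unfolding cmod_power2 minus_complex.sel Qz qq
    using sin_cos_squared_add2[of \<alpha>] sin_cos_squared_add2[of \<beta>] by algebra
  have plus: "(cmod (Q z + cnj q))\<^sup>2 = (cmod (Q z - q))\<^sup>2 + 4 * R * (cos \<alpha> * cos \<beta>)"
    unfolding diff Qz qq by simp
  \<comment> \<open>Replacing \<open>R\<^sup>2 + 1\<close> by its lower bound \<open>2 * R\<close>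
    leaves a factor \<open>2 * R\<close> in every term, which is then cancelled.\<close>
  have "(1 - (norm z)\<^sup>2) * (2 * R) \<le> (1 - (norm z)\<^sup>2) * (R\<^sup>2 + 1)"
  proof (rule mult_left_mono)
    show "2 * R \<le> R\<^sup>2 + 1" using sum_squares_ge_zero[of "R - 1" 0] by (simp add: power2_eq_square algebra_simps)
    show "0 \<le> 1 - (norm z)\<^sup>2" using z by (simp add: abs_square_le_1)
  qed
  with le have "(2 * R) * ((1 - (norm z)\<^sup>2) * (1 - sin \<alpha> * sin \<beta>))
      \<le> (2 * R) * ((1 + (norm z)\<^sup>2) * (cos \<alpha> * cos \<beta>))"
    unfolding plus minus by (simp add: algebra_simps)
  then show ?thesis using \<open>R > 0\<close> unfolding \<alpha>_def \<beta>_def by (simp add: mult_le_cancel_left)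
qed

section \<open>The function \<open>s_minus\<close>\<close>

text \<open>A half-angle formula, giving the shape in which the bound emerges from the Schwarz-Pick
  inequality.\<close>

lemma s_minus_eq:
  assumes "\<bar>b\<bar> < 1"
  shows "s_minus b = 2 / pi * ((1 - sin (pi / 2 * b)) / cos (pi / 2 * b))"
proof -
  define \<theta> where "\<theta> = pi / 4 * (1 + b)"
  have b: "pi / 2 * b = 2 * \<theta> - pi / 2" by (simp add: \<theta>_def algebra_simps)
  have "pi * (1 + b) < pi * 2" using assms by (intro mult_strict_left_mono) auto
  then have "0 < \<theta>" "\<theta> < pi / 2" using assms by (auto simp: \<theta>_def)
  then have "sin \<theta> > 0" "cos \<theta> > 0" by (simp_all add: sin_gt_zero2 cos_gt_zero)
  moreover have "sin (pi / 2 * b) = - cos (2 * \<theta>)" "cos (pi / 2 * b) = sin (2 * \<theta>)"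
    unfolding b by (simp_all add: sin_diff cos_diff)
  ultimately show ?thesis
    unfolding s_minus_def \<theta>_def[symmetric]
    by (simp add: cot_def sin_double cos_double_cos power2_eq_square)
qed

lemma tan_ge_self:
  assumes "0 < x" "x < pi / 2"
  shows "x \<le> tan (x::real)"
  using abs_tan_ge[of x] assms tan_gt_zero[of x] by (simp add: abs_if)

text \<open>The cotangent is the tangent of the complementary angle \<open>pi / 4 * (1 - x)\<close>,
  and the tangent dominates its argument. Positivity of \<open>s_minus\<close> on the interval also
  follows from this bound.\<close>

lemma s_minus_ge:
  assumes "\<bar>x\<bar> < 1"
  shows "s_minus x \<ge> (1 - x) / 2"
proof -
  have "pi * (1 - x) < pi * 2" using assms by (intro mult_strict_left_mono) auto
  then have "pi / 4 * (1 - x) \<le> tan (pi / 4 * (1 - x))"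
    using assms by (intro tan_ge_self) auto
  also have "\<dots> = cot (pi / 4 * (1 + x))"
    unfolding tan_cot'[symmetric] by (rule arg_cong[of _ _ tan]) (simp add: field_simps)
  finally have "2 / pi * (pi / 4 * (1 - x)) \<le> s_minus x"
    unfolding s_minus_def by (intro mult_left_mono) auto
  then show ?thesis by simp
qed

section \<open>Derivatives at a boundary point and functionals on a half-space\<close>

lemma tendsto_directional_derivative:
  fixes u :: "'a::real_normed_vector \<Rightarrow> real"
  assumes u: "(u has_derivative L) (at x within S)"
    and S: "\<And>t. 0 < t \<Longrightarrow> t < T \<Longrightarrow> x + t *\<^sub>R v \<in> S" and "0 < T"
  shows "((\<lambda>t. (u (x + t *\<^sub>R v) - u x) / t) \<longlongrightarrow> L v) (at_right 0)"
proof -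
  have "((\<lambda>t. u (x + t *\<^sub>R v)) has_derivative (\<lambda>r. L (r *\<^sub>R v))) (at 0 within {0<..<T})"
  proof (rule has_derivative_in_compose[where g = u and g' = L])
    show "((\<lambda>t. x + t *\<^sub>R v) has_derivative (\<lambda>r. r *\<^sub>R v)) (at 0 within {0<..<T})"
      by (auto intro!: derivative_eq_intros)
    show "(u has_derivative L) (at (x + 0 *\<^sub>R v) within (\<lambda>t. x + t *\<^sub>R v) ` {0<..<T})"
      using S by (auto intro!: has_derivative_subset[OF u])
  qed
  moreover have "L (r *\<^sub>R v) = L v * r" for r
    using linear_scale[OF has_derivative_linear[OF u]] by simp
  ultimately have "((\<lambda>t. u (x + t *\<^sub>R v)) has_field_derivative L v) (at 0 within {0<..<T})"
    by (simp add: has_field_derivative_def)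
  moreover have at_0: "at 0 within {0<..<T} = at_right 0"
    by (rule at_within_nhd[where S = "{..<T}"]) (use \<open>0 < T\<close> in auto)
  ultimately show ?thesis
    by (simp add: has_field_derivative_iff at_0)
qed

text \<open>Let \<open>v\<close> be the component of \<open>g\<close> orthogonal to
  \<open>n\<close>. Every \<open>v - e *\<^sub>R n\<close> with \<open>e > 0\<close> lies in the
  open half-space, so letting \<open>e\<close> tend to 0 gives
  \<open>inner v v = inner v g \<le> 0\<close>.\<close>

lemma eq_scaleR_of_halfspace:
  fixes g n :: "'a::real_inner"
  assumes n: "norm n = 1" and le: "\<And>v. inner v n < 0 \<Longrightarrow> inner v g \<le> 0"
  shows "g = inner n g *\<^sub>R n"
proof -
  define v where "v = g - inner n g *\<^sub>R n"
  have nn: "inner n n = 1" using n by (simp add: norm_eq_1)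
  have vn: "inner v n = 0" unfolding v_def inner_diff_left inner_scaleR_left nn by (simp add: inner_commute)
  have "inner v v = inner v g"
    by (metis v_def vn inner_diff_right inner_scaleR_right mult_zero_right diff_zero)
  have "inner v g \<le> e * inner n g" if "e > 0" for e
    using le[of "v - e *\<^sub>R n"] vn nn that by (simp add: inner_diff_left)
  then have "eventually (\<lambda>e. inner v g \<le> e * inner n g) (at_right 0)"
    by (simp add: eventually_at_right_less eventually_mono[OF eventually_at_right_less])
  moreover have "((\<lambda>e. e * inner n g) \<longlongrightarrow> 0 * inner n g) (at_right 0)"
    by (intro tendsto_intros)
  ultimately have "inner v g \<le> 0 * inner n g"
    by (intro tendsto_lowerbound) auto
  with \<open>inner v v = inner v g\<close> have "v = 0" by (metis inner_gt_zero_iff mult_zero_left not_less)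
  then show ?thesis by (simp add: v_def)
qed

section \<open>The boundary Schwarz lemma\<close>

theorem proposition2p5:
  fixes f :: "'a::complex_hilbert \<Rightarrow> 'b::complex_hilbert"
    and D :: "'a \<Rightarrow> 'b" and z0 :: 'a and w0 :: 'b
  assumes "f ` ball 0 1 \<subseteq> ball 0 1"
    and "pluriharmonic_on f (ball 0 1)"
    and "z0 \<in> sphere 0 1"
    and "(f has_derivative D) (at z0 within ball 0 1)"
    and "f z0 = w0"
    and "w0 \<in> sphere 0 1"
  shows "(\<exists>l::real. adjoint D w0 = l *\<^sub>R z0 \<and> l \<ge> s_minus (Re (cinner (f 0) w0)))
    \<and> s_minus (Re (cinner (f 0) w0)) > 0
    \<and> (\<forall>x\<in>{-1<..<1}. s_minus x \<ge> (1 - x) / 2)"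
proof -
  define u where "u z = inner (f z) w0" for z
  \<comment> \<open>Pairing \<open>adjoint D w0\<close> with the unit vector \<open>z0\<close> shows
    that this is the only possible multiplier.\<close>
  define l where "l = inner (D z0) w0"
  define b where "b = u 0"
  have z0: "norm z0 = 1" and w0: "norm w0 = 1" using assms(3,6) by auto
  have D: "bounded_linear D" using assms(4) has_derivative_bounded_linear by blast
  have adj: "inner v (adjoint D w0) = inner (D v) w0" for v
    by (rule inner_adjoint[OF D])
  have u1: "\<bar>u z\<bar> < 1" if "norm z < 1" for z
  proof -
    have "f z \<in> ball 0 1" using that assms(1) by (simp add: image_subset_iff)
    then show ?thesis using Cauchy_Schwarz_ineq2[of "f z" w0] w0 by (simp add: u_def)
  qed
  have uz0: "u z0 = 1" using w0 assms(5) by (simp add: u_def norm_eq_1)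
  have du: "(u has_derivative (\<lambda>v. inner (D v) w0)) (at z0 within ball 0 1)"
    unfolding u_def by (rule has_derivative_inner_left[OF assms(4)])

  have half: "inner v (adjoint D w0) \<le> 0" if v: "inner v z0 < 0" for v
  proof -
    \<comment> \<open>The squared norm of \<open>z0 + t *\<^sub>R v\<close> is a quadratic in
      \<open>t\<close> that equals 1 exactly at 0 and \<open>T\<close> and is smaller in
      between.\<close>
    define T where "T = - 2 * inner v z0 / (norm v)\<^sup>2"
    have "v \<noteq> 0" using v by auto
    then have "T > 0" using v by (simp add: T_def divide_neg_pos)
    have ball: "norm (z0 + t *\<^sub>R v) < 1" if "0 < t" "t < T" for t
    proof -
      have "t * (norm v)\<^sup>2 < - 2 * inner v z0"
        using that(2) \<open>v \<noteq> 0\<close> unfolding T_def by (subst (asm) pos_less_divide_eq) auto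
      then have "t * (2 * inner v z0 + t * (norm v)\<^sup>2) < 0"
        using that by (simp add: mult_pos_neg)
      moreover have "(norm (z0 + t *\<^sub>R v))\<^sup>2 = (norm z0)\<^sup>2 + t * (2 * inner v z0 + t * (norm v)\<^sup>2)"
        unfolding power2_norm_eq_inner by (simp add: inner_simps inner_commute algebra_simps)
      ultimately have "(norm (z0 + t *\<^sub>R v))\<^sup>2 < 1\<^sup>2" using z0 by simp
      then show ?thesis by (rule power2_less_imp_less) simp
    qed
    have "((\<lambda>t. (u (z0 + t *\<^sub>R v) - u z0) / t) \<longlongrightarrow> inner (D v) w0) (at_right 0)"
      by (rule tendsto_directional_derivative[OF du _ \<open>T > 0\<close>]) (use ball in auto)
    moreover have "eventually (\<lambda>t. (u (z0 + t *\<^sub>R v) - u z0) / t \<le> 0) (at_right 0)"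
      using eventually_at_right_real[OF \<open>T > 0\<close>]
    proof eventually_elim
      case (elim t)
      then show ?case using u1[OF ball] uz0 by (simp add: divide_le_0_iff abs_less_iff less_imp_le)
    qed
    ultimately show ?thesis unfolding adj by (intro tendsto_upperbound) auto
  qed
  have adjl: "adjoint D w0 = l *\<^sub>R z0"
    using eq_scaleR_of_halfspace[OF z0 half] by (simp add: l_def adj)

  have norm_line: "norm (\<zeta> *\<^sub>C z0) = cmod \<zeta>" for \<zeta> by (simp add: norm_scaleC z0)
  have "{\<zeta>. 0 + \<zeta> *\<^sub>C z0 \<in> ball 0 1} = ball 0 1" by (auto simp: norm_line)
  moreover have "z0 \<noteq> 0" using z0 by auto
  ultimately have "harmonic_on (\<lambda>\<zeta>. cinner (f (0 + \<zeta> *\<^sub>C z0)) w0) (ball 0 1)"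
    using assms(2) unfolding pluriharmonic_on_def by metis
  then obtain F where F: "F holomorphic_on ball 0 1"
    "\<And>\<zeta>. \<zeta> \<in> ball 0 1 \<Longrightarrow> Re (F \<zeta>) = Re (cinner (f (0 + \<zeta> *\<^sub>C z0)) w0)" "Im (F 0) = 0"
    by (rule harmonic_on_imp_Re_holomorphic[where ?z0.0 = 0]) auto
  have ReF: "Re (F \<zeta>) = u (\<zeta> *\<^sub>C z0)" if "norm \<zeta> < 1" for \<zeta>
    using F(2)[of \<zeta>] that by (simp add: u_def Re_cinner)
  have F0: "Re (F 0) = b"
    using ReF[of 0] scaleC_of_real[of 0 z0] by (simp add: b_def)
  define \<beta> where "\<beta> = pi / 2 * b"
  have b: "\<bar>b\<bar> < 1" using u1[of 0] by (simp add: b_def)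
  then have cos\<beta>: "cos \<beta> > 0"
    unfolding \<beta>_def by (rule cos_half_pi_pos)
  \<comment> \<open>\<open>U\<close> follows \<open>u\<close> along the inward radius, with
    \<open>t\<close> the distance to the sphere; hence \<open>(1 - U t) / t\<close> tends to
    \<open>l\<close>.\<close>
  define U where "U t = u (z0 + t *\<^sub>R (- z0))" for t
  have line: "z0 + t *\<^sub>R (- z0) = complex_of_real (1 - t) *\<^sub>C z0" for t
    by (subst scaleC_of_real) (simp add: scaleR_diff_left)
  have "((\<lambda>t. (U t - u z0) / t) \<longlongrightarrow> inner (D (- z0)) w0) (at_right 0)"
    unfolding U_def
  proof (rule tendsto_directional_derivative[OF du, of 1])
    show "z0 + t *\<^sub>R (- z0) \<in> ball 0 1" if "0 < t" "t < 1" for t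
      unfolding line using that by (simp add: norm_line del: of_real_diff)
  qed simp
  from tendsto_minus[OF this]
  have lim: "((\<lambda>t. (1 - U t) / t) \<longlongrightarrow> l) (at_right 0)"
    using linear_neg[OF bounded_linear.linear[OF D]] by (simp add: uz0 l_def minus_divide_left)
  have "((\<lambda>t. 1 - t * ((1 - U t) / t)) \<longlongrightarrow> 1 - 0 * l) (at_right 0)"
    by (intro tendsto_intros lim)
  moreover have "eventually (\<lambda>t. 1 - t * ((1 - U t) / t) = U t) (at_right 0)"
    using eventually_at_right_less[of "0::real"] by eventually_elim simp
  ultimately have limU: "(U \<longlongrightarrow> 1) (at_right 0)"
    by (simp add: tendsto_cong)

  \<comment> \<open>Schwarz-Pick at \<open>1 - t\<close>, divided by \<open>t\<close>. The cosine of
    \<open>pi / 2 * U t\<close> vanishes in the limit; writing it as the sine of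
    \<open>pi / 2 * (1 - U t)\<close> bounds it by a multiple of the difference quotient.\<close>
  have ineq: "(2 - t) * (1 - sin (pi / 2 * U t) * sin \<beta>)
      \<le> (1 + (1 - t)\<^sup>2) * (cos \<beta> * (pi / 2 * ((1 - U t) / t)))" if t: "0 < t" "t < 1" for t
  proof -
    have n: "cmod (complex_of_real (1 - t)) = 1 - t" using t by (simp del: of_real_diff)
    have "\<bar>U t\<bar> < 1" unfolding U_def line by (rule u1) (use t in \<open>simp add: norm_line n del: of_real_diff\<close>)
    have "(1 - (1 - t)\<^sup>2) * (1 - sin (pi / 2 * U t) * sin \<beta>)
        \<le> (1 + (1 - t)\<^sup>2) * (cos (pi / 2 * U t) * cos \<beta>)"
      using strip_schwarz_pick[OF F(1) _ F(3), of "complex_of_real (1 - t)"] u1 t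
      unfolding n F0 \<beta>_def U_def line by (simp add: ReF norm_line n del: of_real_diff)
    moreover have "cos (pi / 2 * U t) \<le> pi / 2 * (1 - U t)"
    proof -
      have "cos (pi / 2 * U t) = sin (pi / 2 * (1 - U t))"
        by (simp add: right_diff_distrib sin_diff)
      also have "\<dots> \<le> pi / 2 * (1 - U t)"
        using \<open>\<bar>U t\<bar> < 1\<close> by (intro sin_x_le_x) auto
      finally show ?thesis .
    qed
    then have "(1 + (1 - t)\<^sup>2) * (cos (pi / 2 * U t) * cos \<beta>)
        \<le> (1 + (1 - t)\<^sup>2) * ((pi / 2 * (1 - U t)) * cos \<beta>)"
      using cos\<beta> by (intro mult_left_mono mult_right_mono) auto
    moreover have "1 - (1 - t)\<^sup>2 = t * (2 - t)"
      by (simp add: power2_eq_square algebra_simps)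
    moreover have "(1 + (1 - t)\<^sup>2) * ((pi / 2 * (1 - U t)) * cos \<beta>)
        = t * ((1 + (1 - t)\<^sup>2) * (cos \<beta> * (pi / 2 * ((1 - U t) / t))))"
      using t by simp
    ultimately have "t * ((2 - t) * (1 - sin (pi / 2 * U t) * sin \<beta>))
        \<le> t * ((1 + (1 - t)\<^sup>2) * (cos \<beta> * (pi / 2 * ((1 - U t) / t))))"
      by (simp only: mult.assoc)
    then show ?thesis by (rule mult_left_le_imp_le) (rule t(1))
  qed
  \<comment> \<open>The limit of \<open>ineq\<close> as \<open>t\<close> tends to 0, left
    unsimplified to match the limit rules; by \<open>s_minus_eq\<close> it amounts to
    \<open>s_minus b \<le> l\<close>.\<close>
  have "(2 - 0) * (1 - sin (pi / 2 * 1) * sin \<beta>) \<le> (1 + (1 - 0)\<^sup>2) * (cos \<beta> * (pi / 2 * l))"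
  proof (rule tendsto_le)
    show "((\<lambda>t. (2 - t) * (1 - sin (pi / 2 * U t) * sin \<beta>)) \<longlongrightarrow> (2 - 0) * (1 - sin (pi / 2 * 1) * sin \<beta>)) (at_right 0)"
      by (intro tendsto_intros limU)
    show "((\<lambda>t. (1 + (1 - t)\<^sup>2) * (cos \<beta> * (pi / 2 * ((1 - U t) / t)))) \<longlongrightarrow>
        (1 + (1 - 0)\<^sup>2) * (cos \<beta> * (pi / 2 * l))) (at_right 0)"
      by (intro tendsto_intros lim)
    show "eventually (\<lambda>t. (2 - t) * (1 - sin (pi / 2 * U t) * sin \<beta>)
        \<le> (1 + (1 - t)\<^sup>2) * (cos \<beta> * (pi / 2 * ((1 - U t) / t)))) (at_right 0)"
      by (rule eventually_mono[OF eventually_at_right_real[of 0 "1::real"]])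
        (simp_all only: ineq greaterThanLessThan_iff zero_less_one)
  qed simp
  then have "1 - sin \<beta> \<le> cos \<beta> * (pi / 2 * l)" by simp
  then have "s_minus b \<le> l"
    using cos\<beta> unfolding s_minus_eq[OF b] \<beta>_def[symmetric] by (simp add: field_simps)
  moreover have "s_minus b > 0" using s_minus_ge[OF b] b by simp
  moreover have "Re (cinner (f 0) w0) = b" by (simp add: b_def u_def Re_cinner)
  ultimately show ?thesis using adjl s_minus_ge by (auto simp: abs_less_iff)
qed

end
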